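(* Let $\omega\in\mathcal{W}_0$ be given and let $\mathcal{M}_\omega=\{W^{(l)}:l>0\}$ be the associated weight matrix, with quotients $\vartheta^{(l)}$. For $x>0$ and $\beta\ge 0$ consider the following growth property of $W^{(x)}$: $$(P_\beta)\qquad \exists\, Q\in\mathbb{N}_{>0}:\quad \liminf_{p\to+\infty}\frac{\vartheta^{(x)}_{Qp}}{\vartheta^{(x)}_p}>Q^{\beta}.$$ Then: (I) For any $\beta\ge 0$ the following are equivalent: (i) There exists $x>0$ such that $W^{(x)}$ satisfies $(P_\beta)$. (ii) There exists $x>0$ such that for all $c\in\mathbb{N}_{>0}$ the sequences $W^{(cx)}$ satisfy $(P_\beta)$ (uniformly with the same choice for $Q$). (II) Moreover, the following are equivalent: (i) There exists $x>0$ such that $W^{(x)}$ satisfies $(P_0)$. (ii) There exists $x>0$ such that for all $c\in\mathbb{N}_{>0}$ the sequences $W^{(cx)}$ and $W^{(x/c)}$ satisfy $(P_0)$.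
   Context: $\mathbb{N}=\{0,1,2,\dots\}$, $\mathbb{N}_{>0}=\{1,2,\dots\}$. $\mathcal{W}_0$ is the set of functions $\omega:[0,+\infty)\to[0,+\infty)$ that are continuous, nondecreasing, satisfy $\omega(t)=0$ for $t\in[0,1]$ and $\lim_{t\to+\infty}\omega(t)=+\infty$, $\log t=o(\omega(t))$ as $t\to+\infty$, and such that $\varphi_\omega:t\mapsto\omega(e^t)$ is convex on $\mathbb{R}$. For $\omega\in\mathcal{W}_0$ put $\varphi^*_\omega(x):=\sup\{xy-\varphi_\omega(y):y\ge0\}$ for $x\ge 0$. The associated weight matrix is $\mathcal{M}_\omega:=\{W^{(l)}:l>0\}$ with $W^{(l)}_p:=\exp\big(\tfrac1l\varphi^*_\omega(lp)\big)$, $p\in\mathbb{N}$; put $\vartheta^{(l)}_p:=W^{(l)}_p/W^{(l)}_{p-1}$ for $p\ge 1$, $\vartheta^{(l)}_0:=1$. *)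

theory Defs
  imports "HOL-Analysis.Analysis" "HOL-Library.Landau_Symbols"
begin

definition phi :: "(real \<Rightarrow> real) \<Rightarrow> real \<Rightarrow> real" where
  "phi \<omega> t = \<omega> (exp t)"

(* A weight function on [0,\<infinity>) is represented by a total function on the reals; its values on
   the negative half-line are unconstrained and never used. *)
definition W0 :: "(real \<Rightarrow> real) set" where
  "W0 = {\<omega>. (\<forall>t\<ge>0. \<omega> t \<ge> 0)
           \<and> continuous_on {0..} \<omega>
           \<and> mono_on {0..} \<omega>
           \<and> (\<forall>t\<in>{0..1}. \<omega> t = 0)
           \<and> filterlim \<omega> at_top at_top
           \<and> (\<lambda>t. ln t) \<in> o[at_top](\<omega>)
           \<and> convex_on UNIV (phi \<omega>)}"

(* The supremum is taken in the reals; by phi_star_bdd_above below it is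
   finite for every \<omega> in W0, so this is the usual Young conjugate. *)
definition phi_star :: "(real \<Rightarrow> real) \<Rightarrow> real \<Rightarrow> real" where
  "phi_star \<omega> x = (SUP y\<in>{0..}. x * y - phi \<omega> y)"

definition weight_seq :: "(real \<Rightarrow> real) \<Rightarrow> real \<Rightarrow> nat \<Rightarrow> real" where
  "weight_seq \<omega> l p = exp (phi_star \<omega> (l * real p) / l)"

definition quotients :: "(nat \<Rightarrow> real) \<Rightarrow> nat \<Rightarrow> real" where
  "quotients M p = (if p = 0 then 1 else M p / M (p - 1))"

(* The liminf is taken in the extended reals, so the value \<infinity> is allowed. *)
definition growth_with :: "nat \<Rightarrow> real \<Rightarrow> (nat \<Rightarrow> real) \<Rightarrow> bool" where
  "growth_with Q \<beta> M \<longleftrightarrow>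
     liminf (\<lambda>p. ereal (quotients M (Q * p) / quotients M p)) > ereal (real Q powr \<beta>)"

definition growth :: "real \<Rightarrow> (nat \<Rightarrow> real) \<Rightarrow> bool" where
  "growth \<beta> M \<longleftrightarrow> (\<exists>Q>0. growth_with Q \<beta> M)"

lemma phi_star_bdd_above:
  assumes "\<omega> \<in> W0" "x \<ge> 0"
  shows "bdd_above ((\<lambda>y. x * y - phi \<omega> y) ` {0..})"
proof -
  have o: "(\<lambda>t. ln t) \<in> o[at_top](\<omega>)" and pos: "\<And>t. t \<ge> 0 \<Longrightarrow> \<omega> t \<ge> 0"
    using assms(1) unfolding W0_def by auto
  have c: "1 / (x + 1) > 0" using assms(2) by simp
  have "eventually (\<lambda>t. norm (ln t) \<le> 1 / (x + 1) * norm (\<omega> t)) at_top"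
    using landau_o.smallD[OF o c] by simp
  then obtain T where T: "\<And>t. t \<ge> T \<Longrightarrow> \<bar>ln t\<bar> \<le> 1 / (x + 1) * \<bar>\<omega> t\<bar>"
    unfolding eventually_at_top_linorder by auto
  have "x * y - phi \<omega> y \<le> x * \<bar>T\<bar>" if "y \<ge> 0" for y
  proof (cases "exp y \<ge> T")
    case True
    have "y \<le> 1 / (x + 1) * \<omega> (exp y)"
      using T[OF True] pos[of "exp y"] that by simp
    then have "(x + 1) * y \<le> \<omega> (exp y)"
      using assms(2) by (simp add: field_simps)
    then have "x * y - phi \<omega> y \<le> 0"
      using that by (simp add: phi_def algebra_simps)
    also have "\<dots> \<le> x * \<bar>T\<bar>" using assms(2) by simp
    finally show ?thesis .
  next
    case False
    then have "y \<le> \<bar>T\<bar>" using exp_ge_add_one_self[of y] by linarith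
    then have "x * y \<le> x * \<bar>T\<bar>" using assms(2) by (intro mult_left_mono)
    then show ?thesis using pos[of "exp y"] by (simp add: phi_def)
  qed
  then show ?thesis by (intro bdd_aboveI2) auto
qed

end

theory Submission
  imports Defs
begin

text \<open>
  Since \<open>ln W\<^sup>(\<^sup>l\<^sup>)\<^sub>p = \<phi>\<^sup>*(l p) / l\<close>, the number \<open>ln \<theta>\<^sup>(\<^sup>l\<^sup>)\<^sub>p\<close> is the slope of the convex function
  \<open>\<phi>\<^sup>*\<close> over the interval \<open>[l (p - 1), l p]\<close>, and \<open>(P\<^sub>\<beta>)\<close> says that the slopes at \<open>Q p\<close> and \<open>p\<close>
  eventually differ by some constant exceeding \<open>\<beta> ln Q\<close>.
  A slope with step \<open>c x\<close> is the mean of \<open>c\<close> consecutive slopes with step \<open>x\<close>; comparing the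
  means term by term transfers the property from \<open>x\<close> to \<open>c x\<close> with the same \<open>Q\<close> and the same
  constant. In the other direction, slopes with the finer step \<open>x / c\<close> are trapped between slopes
  with step \<open>x\<close> at nearby indices; enlarging \<open>Q\<close> to \<open>2 Q\<close> absorbs the rounding errors, which is
  harmless for \<open>\<beta> = 0\<close> only.
\<close>

text \<open>The difference is taken backwards from the right endpoint \<open>t\<close>, to match the
  quotient of the terms at \<open>p\<close> and \<open>p - 1\<close> when
  \<open>t = l * real p\<close>.\<close>

definition slope :: "(real \<Rightarrow> real) \<Rightarrow> real \<Rightarrow> real \<Rightarrow> real" where
  "slope f h t = (f t - f (t - h)) / h"

text \<open>Both slopes are compared with that of the chord from \<open>a\<close> to
  \<open>d\<close>: moving the right end from \<open>b\<close> to \<open>d\<close> and then the left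
  end from \<open>a\<close> to \<open>c\<close> can only raise the slope.\<close>

lemma convex_on_slope_mono:
  fixes f :: "real \<Rightarrow> real"
  assumes "convex_on S f" "{a, b, c, d} \<subseteq> S" "a < b" "c < d" "a \<le> c" "b \<le> d"
  shows "(f b - f a) / (b - a) \<le> (f d - f c) / (d - c)"
proof -
  have "(f b - f a) / (b - a) \<le> (f d - f a) / (d - a)"
  proof (cases "b = d")
    case False
    have "(f a - f b) / (a - b) \<le> (f a - f d) / (a - d)"
      using assms False by (intro convex_on_slope_le(1)[OF assms(1)]) auto
    then show ?thesis
      by (metis minus_diff_eq minus_divide_divide)
  qed auto
  also have "\<dots> \<le> (f d - f c) / (d - c)"
  proof (cases "a = c")
    case False
    have "(f a - f d) / (a - d) \<le> (f c - f d) / (c - d)"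
      using assms False by (intro convex_on_slope_le(2)[OF assms(1)]) auto
    then show ?thesis
      by (metis minus_diff_eq minus_divide_divide)
  qed auto
  finally show ?thesis .
qed

lemma slope_mono:
  assumes "convex_on {0..} f" "0 < h" "0 < k" "h \<le> s" "s \<le> t" "s - h \<le> t - k"
  shows "slope f h s \<le> slope f k t"
  using convex_on_slope_mono[of "{0..}" f "s - h" s "t - k" t] assms
  by (simp add: slope_def)

text \<open>The \<open>c\<close> intervals of length \<open>h\<close> tile the interval of length
  \<open>c * h\<close> ending at \<open>t\<close>, so the increments telescope.\<close>

lemma slope_mult_step:
  assumes "h > 0" "c > 0"
  shows "slope f (real c * h) t = (\<Sum>j<c. slope f h (t - real j * h)) / real c"
proof -
  have "(\<Sum>j<c. slope f h (t - real j * h))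
      = (\<Sum>j<c. f (t - real j * h) - f (t - real (Suc j) * h)) / h"
    by (simp add: slope_def sum_divide_distrib algebra_simps)
  also have "\<dots> = (f t - f (t - real c * h)) / h"
    by (subst sum_lessThan_telescope') simp
  finally show ?thesis
    using assms by (simp add: slope_def)
qed

text \<open>A supremum of affine functions is convex. Membership in \<open>W0\<close> makes the
  family bounded above, so that the real \<open>SUP\<close> really dominates each of them.\<close>

lemma convex_on_phi_star:
  assumes "\<omega> \<in> W0"
  shows "convex_on {0..} (phi_star \<omega>)"
proof (rule convex_onI)
  fix t x y :: real
  assume t: "0 < t" "t < 1" and "x \<in> {0..}" "y \<in> {0..}"
  then have x: "x \<ge> 0" and y: "y \<ge> 0" by auto
  have upper: "u * v - phi \<omega> v \<le> phi_star \<omega> u" if "u \<ge> 0" "v \<ge> 0" for u v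
    unfolding phi_star_def
    using phi_star_bdd_above[OF assms that(1)] that(2) by (intro cSUP_upper) auto
  have "((1 - t) * x + t * y) * v - phi \<omega> v \<le> (1 - t) * phi_star \<omega> x + t * phi_star \<omega> y"
    if "v \<ge> 0" for v
  proof -
    have "((1 - t) * x + t * y) * v - phi \<omega> v
        = (1 - t) * (x * v - phi \<omega> v) + t * (y * v - phi \<omega> v)"
      by (simp add: algebra_simps)
    also have "\<dots> \<le> (1 - t) * phi_star \<omega> x + t * phi_star \<omega> y"
      using t upper[OF x that] upper[OF y that] by (intro add_mono mult_left_mono) auto
    finally show ?thesis .
  qed
  then show "phi_star \<omega> ((1 - t) *\<^sub>R x + t *\<^sub>R y) \<le> (1 - t) * phi_star \<omega> x + t * phi_star \<omega> y"
    unfolding phi_star_def[of \<omega> "(1 - t) *\<^sub>R x + t *\<^sub>R y"]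
    by (intro cSUP_least) auto
qed simp

lemma quotients_weight_seq:
  assumes "p > 0"
  shows "quotients (weight_seq \<omega> l) p = exp (slope (phi_star \<omega>) l (l * real p))"
proof -
  have "l * real (p - 1) = l * real p - l"
    using assms by (simp add: of_nat_diff algebra_simps)
  then show ?thesis
    using assms
    by (simp add: quotients_def weight_seq_def slope_def flip: exp_diff diff_divide_distrib)
qed

text \<open>The strict inequality becomes a fixed margin \<open>r > C\<close>, which survives
  averaging over finitely many indices.\<close>

lemma less_liminf_ereal_iff:
  fixes X :: "nat \<Rightarrow> real"
  shows "ereal C < liminf (\<lambda>n. ereal (X n)) \<longleftrightarrow> (\<exists>r>C. eventually (\<lambda>n. r \<le> X n) sequentially)"
proof
  assume "ereal C < liminf (\<lambda>n. ereal (X n))"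
  then obtain r where r: "C < r" "ereal r < liminf (\<lambda>n. ereal (X n))"
    using ereal_dense2 by (metis less_ereal.simps(1))
  then have "eventually (\<lambda>n. r \<le> X n) sequentially"
    by (auto dest!: less_LiminfD elim: eventually_mono)
  with r show "\<exists>r>C. eventually (\<lambda>n. r \<le> X n) sequentially" by blast
next
  assume "\<exists>r>C. eventually (\<lambda>n. r \<le> X n) sequentially"
  then obtain r where r: "C < r" "eventually (\<lambda>n. r \<le> X n) sequentially" by blast
  then have "ereal r \<le> liminf (\<lambda>n. ereal (X n))"
    by (intro Liminf_bounded) simp
  with r(1) show "ereal C < liminf (\<lambda>n. ereal (X n))"
    using less_le_trans by (metis less_ereal.simps(1))
qed

lemma growth_with_weight_seq_iff:
  assumes "Q > 0"
  shows "growth_with Q \<beta> (weight_seq \<omega> l) \<longleftrightarrow>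
    (\<exists>r>\<beta> * ln (real Q). eventually (\<lambda>p. slope (phi_star \<omega>) l (l * real p) + r
       \<le> slope (phi_star \<omega>) l (l * real (Q * p))) sequentially)"
proof -
  define D where
    "D p = slope (phi_star \<omega>) l (l * real (Q * p)) - slope (phi_star \<omega>) l (l * real p)" for p
  let ?W = "weight_seq \<omega> l"
  \<comment> \<open>Only \<open>p = 0\<close> is exceptional: there \<open>quotients\<close> has the
    default value 1, which does not come from a slope.\<close>
  have "eventually (\<lambda>p. quotients ?W (Q * p) / quotients ?W p = exp (D p)) sequentially"
    using eventually_gt_at_top[of 0]
    by eventually_elim (use assms in \<open>simp add: quotients_weight_seq D_def exp_diff\<close>)
  then have "liminf (\<lambda>p. ereal (quotients ?W (Q * p) / quotients ?W p)) = liminf (\<lambda>p. ereal (exp (D p)))"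
    by (intro Liminf_eq) (auto elim: eventually_mono)
  moreover have "real Q powr \<beta> = exp (\<beta> * ln (real Q))"
    using assms by (simp add: powr_def)
  ultimately have "growth_with Q \<beta> ?W \<longleftrightarrow>
      (\<exists>e>exp (\<beta> * ln (real Q)). eventually (\<lambda>p. e \<le> exp (D p)) sequentially)"
    unfolding growth_with_def by (simp only: less_liminf_ereal_iff)
  also have "\<dots> \<longleftrightarrow> (\<exists>r>\<beta> * ln (real Q). eventually (\<lambda>p. r \<le> D p) sequentially)"
  proof
    assume "\<exists>e>exp (\<beta> * ln (real Q)). eventually (\<lambda>p. e \<le> exp (D p)) sequentially"
    then obtain e where e: "exp (\<beta> * ln (real Q)) < e" "eventually (\<lambda>p. e \<le> exp (D p)) sequentially"
      by blast
    then have "e > 0" using exp_gt_zero less_trans by blast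
    with e(2) have "eventually (\<lambda>p. ln e \<le> D p) sequentially"
      by (metis (mono_tags, lifting) eventually_mono exp_le_cancel_iff exp_ln)
    moreover have "\<beta> * ln (real Q) < ln e"
      using e(1) \<open>e > 0\<close> by (metis exp_less_cancel_iff exp_ln)
    ultimately show "\<exists>r>\<beta> * ln (real Q). eventually (\<lambda>p. r \<le> D p) sequentially"
      by blast
  next
    assume "\<exists>r>\<beta> * ln (real Q). eventually (\<lambda>p. r \<le> D p) sequentially"
    then show "\<exists>e>exp (\<beta> * ln (real Q)). eventually (\<lambda>p. e \<le> exp (D p)) sequentially"
      by (metis (mono_tags, lifting) exp_le_cancel_iff exp_less_cancel_iff eventually_mono)
  qed
  finally show ?thesis by (simp add: D_def le_diff_eq add.commute)
qed

text \<open>Each of the \<open>c\<close> fine slopes that make up the coarse slope at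
  \<open>p\<close> grows by at least \<open>r\<close>, hence so does their mean; \<open>Q\<close>
  and \<open>r\<close> are unchanged.\<close>

lemma growth_with_weight_seq_mult:
  assumes "\<omega> \<in> W0" "x > 0" "Q > 0" "c > 0" "growth_with Q \<beta> (weight_seq \<omega> x)"
  shows "growth_with Q \<beta> (weight_seq \<omega> (real c * x))"
proof -
  define s where "s = slope (phi_star \<omega>)"
  note convex = convex_on_phi_star[OF assms(1)]
  obtain r N where r: "r > \<beta> * ln (real Q)"
    and N: "\<And>p. p \<ge> N \<Longrightarrow> s x (x * real p) + r \<le> s x (x * real (Q * p))"
    using assms unfolding growth_with_weight_seq_iff[OF assms(3)] eventually_sequentially s_def
    by blast
  have "s (real c * x) (real c * x * real p) + r \<le> s (real c * x) (real c * x * real (Q * p))"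
    if p: "p > N" for p
  proof -
    have shifted: "s x (real c * x * real p - real j * x) + r
        \<le> s x (real c * x * real (Q * p) - real j * x)" if j: "j < c" for j
    proof -
      define q where "q = c * p - j"
      have "c * p = c * (p - 1) + c"
        using p by (cases p) auto
      \<comment> \<open>As \<open>j < c\<close>, this gives
        \<open>q > c * (p - 1) \<ge> p - 1 \<ge> N\<close>, so the hypothesis applies at every index
        \<open>q\<close> that occurs.\<close>
      moreover have "c * (p - 1) \<ge> p - 1"
        using assms(4) by simp
      ultimately have q: "q \<ge> N" "q > 0" "c * p = q + j"
        unfolding q_def using j p by linarith+
      have rq: "real c * real p = real q + real j"
        using q(3) by (metis of_nat_add of_nat_mult)
      have eq: "real c * x * real p - real j * x = x * real q"
        using arg_cong[OF rq, of "\<lambda>u. x * u"] by (simp add: algebra_simps)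
      have "real c * x * real (Q * p) = x * real Q * (real q + real j)"
        using arg_cong[OF rq, of "\<lambda>u. x * real Q * u"] by (simp add: algebra_simps)
      \<comment> \<open>The hypothesis at \<open>q\<close> reaches only \<open>x * Q * q\<close>.
        The required endpoint lies further right by \<open>x * j * (Q - 1)\<close>, nonnegative
        since \<open>Q \<ge> 1\<close>, and monotonicity of slopes bridges the gap.\<close>
      then have eq2: "real c * x * real (Q * p) - real j * x
          = x * real (Q * q) + x * real j * (real Q - 1)"
        by (simp add: algebra_simps)
      have "s x (x * real q) + r \<le> s x (x * real (Q * q))"
        by (rule N[OF q(1)])
      also have "\<dots> \<le> s x (real c * x * real (Q * p) - real j * x)"
      proof -
        have "x * 1 \<le> x * real (Q * q)"
          using assms(2,3) q(2) by (intro mult_left_mono) (auto simp: Suc_le_eq simp del: of_nat_mult)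
        moreover have "x * real j * (real Q - 1) \<ge> 0"
          using assms(2,3) by simp
        ultimately show ?thesis
          unfolding s_def eq2 using assms(2) by (intro slope_mono[OF convex]) auto
      qed
      finally show ?thesis by (simp only: eq)
    qed
    have "(\<Sum>j<c. s x (real c * x * real p - real j * x) + r)
        \<le> (\<Sum>j<c. s x (real c * x * real (Q * p) - real j * x))"
      by (intro sum_mono shifted) auto
    from divide_right_mono[OF this, of "real c"] show ?thesis
      using assms(4) unfolding s_def slope_mult_step[OF assms(2,4)]
      by (simp add: sum.distrib add_divide_distrib)
  qed
  then show ?thesis
    unfolding growth_with_weight_seq_iff[OF assms(3)] eventually_sequentially s_def
    using r by (meson Suc_le_eq)
qed

text \<open>The index \<open>p\<close> is rounded up to a coarse index \<open>k\<close>, the gain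
  \<open>r\<close> is taken from \<open>k\<close> to \<open>Q * k\<close>, and the result is bounded
  by the fine slope at \<open>2 * Q * p\<close>. For exponent 0 the required margin is 0 both for
  \<open>Q\<close> and for \<open>2 * Q\<close>.\<close>

lemma growth_0_weight_seq_divide:
  assumes "\<omega> \<in> W0" "x > 0" "c > 0" "growth 0 (weight_seq \<omega> x)"
  shows "growth 0 (weight_seq \<omega> (x / real c))"
proof -
  define s where "s = slope (phi_star \<omega>)"
  define y where "y = x / real c"
  have y: "y > 0" and x_eq: "x = real c * y"
    using assms by (auto simp: y_def)
  note convex = convex_on_phi_star[OF assms(1)]
  obtain Q where Q: "Q > 0" "growth_with Q 0 (weight_seq \<omega> x)"
    using assms(4) by (auto simp: growth_def)
  then obtain r N where r: "r > 0"
    and N: "\<And>p. p \<ge> N \<Longrightarrow> s x (x * real p) + r \<le> s x (x * real (Q * p))"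
    unfolding growth_with_weight_seq_iff[OF Q(1)] eventually_sequentially s_def by auto
  have "s y (y * real p) + r \<le> s y (y * real (2 * Q * p))"
    \<comment> \<open>The term \<open>c * N\<close> ensures \<open>k \<ge> N\<close>; the rest
      ensures \<open>Q * (p + 2 * c + 1) \<le> 2 * Q * p\<close>.\<close>
    if p: "p \<ge> c * N + 2 * c + 1" for p
  proof -
    \<comment> \<open>Adding 2 puts even the left end \<open>x * (k - 1)\<close> of the coarse
      interval to the right of \<open>y * p\<close>.\<close>
    define k where "k = p div c + 2"
    have "p = c * (p div c) + p mod c" "p mod c < c"
      using assms(3) by auto
    then have k: "p + c < c * k" "c * k \<le> p + 2 * c"
      unfolding k_def distrib_left by linarith+
    have "c * N < c * k" using k p by linarith
    then have kN: "k \<ge> N" by simp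
    have "s y (y * real p) \<le> s x (x * real k)"
    proof -
      have "y * (real p + real c) \<le> y * (real c * real k)"
        using k(1) y by (intro mult_left_mono) (auto simp flip: of_nat_mult of_nat_add)
      moreover have "y * 1 \<le> y * real p" using y p by (intro mult_left_mono) auto
      moreover have "real p \<le> real c * real k"
        using k(1) by (simp flip: of_nat_mult)
      moreover have "real c * y > 0" using assms(3) y by simp
      ultimately show ?thesis
        unfolding s_def x_eq using y
        by (intro slope_mono[OF convex]) (auto simp: algebra_simps)
    qed
    also have "s x (x * real k) + r \<le> s x (x * real (Q * k))"
      by (rule N[OF kN])
    also have "\<dots> \<le> s y (y * real (2 * Q * p))"
    proof -
      \<comment> \<open>The extra 1 leaves room for one fine step: the interval of length
        \<open>y\<close> ending at \<open>y * (2 * Q * p)\<close> must start no earlier than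
        \<open>x * (Q * k)\<close>.\<close>
      have "c * (Q * k) + 1 \<le> Q * (p + 2 * c) + 1"
        using k(2) by (metis add_le_mono1 mult.left_commute mult_le_mono2)
      also have "\<dots> \<le> Q * (p + 2 * c + 1)" using Q(1) by simp
      also have "\<dots> \<le> Q * (2 * p)" using p by (intro mult_le_mono2) linarith
      finally have le: "real c * real (Q * k) + 1 \<le> real (2 * Q * p)"
        by (simp add: mult.assoc mult.left_commute flip: of_nat_mult of_nat_Suc)
      have le': "y * (real c * real (Q * k) + 1) \<le> y * real (2 * Q * p)"
        using y by (intro mult_left_mono le) auto
      have "x * 1 \<le> x * real (Q * k)"
        using assms(2) Q(1) unfolding k_def
        by (intro mult_left_mono) (auto simp: Suc_le_eq simp del: of_nat_mult)
      moreover have "real c * real (Q * k) \<le> real (2 * Q * p)"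
        using le by linarith
      ultimately show ?thesis
        using le' unfolding s_def using y assms(2)
        by (intro slope_mono[OF convex]) (auto simp: x_eq algebra_simps)
    qed
    finally show ?thesis by simp
  qed
  then have "growth_with (2 * Q) 0 (weight_seq \<omega> y)"
    using Q(1) r by (subst growth_with_weight_seq_iff) (auto simp: eventually_sequentially s_def)
  then show ?thesis
    using Q(1) unfolding growth_def y_def by (metis mult_pos_pos zero_less_numeral)
qed

theorem propositionA1:
  fixes \<omega> :: "real \<Rightarrow> real"
  assumes "\<omega> \<in> W0"
  shows "(\<forall>\<beta>\<ge>0::real.
            (\<exists>x>0. growth \<beta> (weight_seq \<omega> x))
            \<longleftrightarrow> (\<exists>x>0. \<exists>Q>0. \<forall>c::nat. c > 0 \<longrightarrow> growth_with Q \<beta> (weight_seq \<omega> (real c * x))))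
       \<and> ((\<exists>x>0. growth 0 (weight_seq \<omega> x))
            \<longleftrightarrow> (\<exists>x>0. \<forall>c::nat. c > 0 \<longrightarrow>
                   growth 0 (weight_seq \<omega> (real c * x)) \<and> growth 0 (weight_seq \<omega> (x / real c))))"
proof (intro conjI allI impI)
  fix \<beta> :: real
  \<comment> \<open>The same \<open>x\<close> and \<open>Q\<close> serve in both directions; the
    converse is the case \<open>c = 1\<close>.\<close>
  show "(\<exists>x>0. growth \<beta> (weight_seq \<omega> x))
    \<longleftrightarrow> (\<exists>x>0. \<exists>Q>0. \<forall>c::nat. c > 0 \<longrightarrow> growth_with Q \<beta> (weight_seq \<omega> (real c * x)))"
    unfolding growth_def
    by (metis assms growth_with_weight_seq_mult mult_1 of_nat_1 zero_less_one)
next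
  have "growth 0 (weight_seq \<omega> (real c * x))"
    if "x > 0" "c > 0" "growth 0 (weight_seq \<omega> x)" for x and c :: nat
    using that growth_with_weight_seq_mult[OF assms] unfolding growth_def by blast
  then show "(\<exists>x>0. growth 0 (weight_seq \<omega> x))
    \<longleftrightarrow> (\<exists>x>0. \<forall>c::nat. c > 0 \<longrightarrow>
           growth 0 (weight_seq \<omega> (real c * x)) \<and> growth 0 (weight_seq \<omega> (x / real c)))"
    by (metis assms growth_0_weight_seq_divide mult_1 of_nat_1 zero_less_one)
qed

end
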